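(* Let $d\ge 2$ and let $K_1,\ldots,K_N$ be (not necessarily distinct) unconditional convex bodies in $\mathbb{E}^d$. Let $\mathbf{p}=(p_1,\ldots,p_N)$ and $\mathbf{q}=(q_1,\ldots,q_N)$ be configurations of $N$ points in $\mathbb{E}^d$ such that $\mathbf{q}$ is a strong contraction of $\mathbf{p}$. Then $$V_d\left(\bigcup_{i=1}^{N}(p_i+K_i)\right)\ge V_d\left(\bigcup_{i=1}^{N}(q_i+K_i)\right)$$ and $$V_d\left(\bigcap_{i=1}^{N}(p_i+K_i)\right)\le V_d\left(\bigcap_{i=1}^{N}(q_i+K_i)\right).$$
   Context: $\mathbb{E}^d$ is $d$-dimensional Euclidean space; the coordinates of $x\in\mathbb{E}^d$ are written $x=(x^{(1)},\ldots,x^{(d)})$. $V_d$ denotes $d$-dimensional volume (Lebesgue measure). A convex body in $\mathbb{E}^d$ is a compact convex set with non-empty interior. A convex body $K$ is called unconditional if for every $x=(x^{(1)},\ldots,x^{(d)})\in K$ also $(\pm x^{(1)},\ldots,\pm x^{(d)})\in K$ for all choices of signs. The configuration $\mathbf{q}=(q_1,\ldots,q_N)$ is a strong contraction of $\mathbf{p}=(p_1,\ldots,p_N)$ if $|q_i^{(k)}-q_j^{(k)}|\le|p_i^{(k)}-p_j^{(k)}|$ for all $1\le k\le d$ and all $1\le i<j\le N$. *)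

theory Defs
  imports "HOL-Analysis.Analysis"
begin

definition convex_body :: "(real ^ 'n) set \<Rightarrow> bool" where
  "convex_body K \<longleftrightarrow> compact K \<and> convex K \<and> interior K \<noteq> {}"

text \<open>The function \<open>s\<close> ranges over all choices of signs, one for each coordinate.\<close>

definition unconditional :: "(real ^ 'n) set \<Rightarrow> bool" where
  "unconditional K \<longleftrightarrow>
     (\<forall>x\<in>K. \<forall>s :: 'n \<Rightarrow> real. (\<forall>k. s k = 1 \<or> s k = -1) \<longrightarrow> (\<chi> k. s k * x $ k) \<in> K)"

text \<open>A configuration of \<open>N\<close> points is a function on \<open>nat\<close> of which only the values at
  \<open>1, \<dots>, N\<close> matter. The contracted configuration is the second argument, the original
  one the third.\<close>

definition strong_contraction ::
  "nat \<Rightarrow> (nat \<Rightarrow> real ^ 'n) \<Rightarrow> (nat \<Rightarrow> real ^ 'n) \<Rightarrow> bool" where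
  "strong_contraction N q p \<longleftrightarrow>
     (\<forall>k. \<forall>i j. 1 \<le> i \<and> i < j \<and> j \<le> N \<longrightarrow>
        \<bar>q i $ k - q j $ k\<bar> \<le> \<bar>p i $ k - p j $ k\<bar>)"

end

theory Submission
  imports Defs
begin

text \<open>
  The coordinates of the points are moved one at a time. While only the \<open>k\<close>-th coordinates
  change, Fubini reduces the comparison to lines parallel to the \<open>k\<close>-th axis. Such a line meets
  an unconditional convex body \<open>K i\<close> in a segment symmetric about the hyperplane where the
  \<open>k\<close>-th coordinate vanishes, so it meets the translates of \<open>K i\<close> in segments centred at the
  \<open>k\<close>-th coordinates of the translation vectors; the half-lengths of these segments depend only
  on the other coordinates and are therefore the same before and after the move. This leaves the
  same statement for segments of arbitrary lengths on the real line, whose centres approach each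
  other (\<open>emeasure_INT_intervals_mono\<close> and \<open>emeasure_UN_intervals_mono\<close>).

  On the line both inequalities come down to two segments. The intersection of segments has length
  equal to the least of all \<open>c j + r j - (c i - r i)\<close> (or 0 if that is negative). Over both
  orders of \<open>i\<close> and \<open>j\<close> the smaller value is \<open>r i + r j - \<bar>c i - c j\<bar>\<close>, so the minimum
  can only grow. If a union
  of segments is connected, its length is the largest distance between endpoints of its
  members, and after the contraction no two endpoints are further apart than that; a disconnected
  union is split into two disjoint parts, which are treated separately by induction.
\<close>

section \<open>Contracting the centres of intervals on the line\<close>

lemma emeasure_INT_intervals_mono:
  fixes c d r :: "'i \<Rightarrow> real"
  assumes "finite I" "I \<noteq> {}"
    and contr: "\<And>i j. i \<in> I \<Longrightarrow> j \<in> I \<Longrightarrow> \<bar>d i - d j\<bar> \<le> \<bar>c i - c j\<bar>"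
  shows "emeasure lborel (\<Inter>i\<in>I. {c i - r i .. c i + r i})
       \<le> emeasure lborel (\<Inter>i\<in>I. {d i - r i .. d i + r i})"
proof (cases "(\<Inter>i\<in>I. {c i - r i .. c i + r i}) = {}")
  case False
  have Icc: "\<exists>a\<in>I. \<exists>b\<in>I. (\<Inter>i\<in>I. {f i - r i .. f i + r i}) = {f a - r a .. f b + r b}"
    for f :: "'i \<Rightarrow> real"
  proof -
    obtain a where a: "a \<in> I" "Max ((\<lambda>i. f i - r i) ` I) = f a - r a"
      using obtains_MAX[OF assms(1,2)] .
    obtain b where b: "b \<in> I" "Min ((\<lambda>i. f i + r i) ` I) = f b + r b"
      using obtains_MIN[OF assms(1,2)] .
    have "f i - r i \<le> f a - r a" "f b + r b \<le> f i + r i" if "i \<in> I" for i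
      unfolding a(2)[symmetric] b(2)[symmetric] using that \<open>finite I\<close> by simp_all
    then have "{f a - r a .. f b + r b} \<subseteq> {f i - r i .. f i + r i}" if "i \<in> I" for i
      using that by simp
    moreover have "(\<Inter>i\<in>I. {f i - r i .. f i + r i})
        \<subseteq> {f a - r a .. f a + r a} \<inter> {f b - r b .. f b + r b}"
      using a(1) b(1) by (intro Int_greatest INT_lower)
    ultimately have "(\<Inter>i\<in>I. {f i - r i .. f i + r i}) = {f a - r a .. f b + r b}"
      by (intro equalityI INT_greatest) (auto dest: subsetD)
    with a(1) b(1) show ?thesis
      by blast
  qed
  from Icc[of d] obtain a b where "a \<in> I" "b \<in> I"
    and d: "(\<Inter>i\<in>I. {d i - r i .. d i + r i}) = {d a - r a .. d b + r b}"
    by blast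
  from Icc[of c] obtain L U where c: "(\<Inter>i\<in>I. {c i - r i .. c i + r i}) = {L..U}"
    by blast
  with False have "L \<le> U"
    by simp
  then have "L \<in> {c i - r i .. c i + r i}" "U \<in> {c i - r i .. c i + r i}" if "i \<in> I" for i
    using that INT_lower[of i I "\<lambda>i. {c i - r i .. c i + r i}"] unfolding c by auto
  from this[OF \<open>a \<in> I\<close>] this[OF \<open>b \<in> I\<close>] have "U - L \<le> r a + r b - \<bar>c a - c b\<bar>"
    by (simp add: abs_if)
  also have "\<dots> \<le> (d b + r b) - (d a - r a)"
    using contr[OF \<open>a \<in> I\<close> \<open>b \<in> I\<close>] by linarith
  finally show ?thesis
    using \<open>L \<le> U\<close> unfolding c d by (simp add: ennreal_leI)
qed simp

text \<open>
  The induction splits a disconnected union into smaller ones. A connected union is an interval,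
  and nonnegative radii ensure that it contains both endpoints of every original segment, so its
  length bounds all distances between them.
\<close>

lemma emeasure_UN_nonempty_intervals_mono:
  fixes c d r :: "'i \<Rightarrow> real"
  assumes "finite I"
    and r: "\<And>i. i \<in> I \<Longrightarrow> 0 \<le> r i"
    and contr: "\<And>i j. i \<in> I \<Longrightarrow> j \<in> I \<Longrightarrow> \<bar>d i - d j\<bar> \<le> \<bar>c i - c j\<bar>"
  shows "emeasure lborel (\<Union>i\<in>I. {d i - r i .. d i + r i})
       \<le> emeasure lborel (\<Union>i\<in>I. {c i - r i .. c i + r i})"
  using assms
proof (induction I rule: finite_psubset_induct)
  case (psubset I)
  let ?C = "\<lambda>i. {c i - r i .. c i + r i}" and ?D = "\<lambda>i. {d i - r i .. d i + r i}"
  have closed: "closed (\<Union>i\<in>J. ?C i)" if "J \<subseteq> I" for J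
    using that psubset.hyps by (intro closed_UN) (auto intro: finite_subset)
  have borel: "(\<Union>i\<in>J. ?C i) \<in> sets lborel" "(\<Union>i\<in>J. ?D i) \<in> sets lborel" if "J \<subseteq> I" for J
    using that psubset.hyps by (auto intro!: sets.finite_UN dest: finite_subset)
  consider "I = {}" | "I \<noteq> {}" "connected (\<Union>i\<in>I. ?C i)" | "\<not> connected (\<Union>i\<in>I. ?C i)"
    by blast
  then show ?case
  proof cases
    case 1
    then show ?thesis by simp
  next
    case 2
    \<comment> \<open>The union of the original segments is one interval \<open>{L..U}\<close>; any two endpoints of
      contracted segments are at distance at most \<open>U - L\<close>.\<close>
    have "compact (\<Union>i\<in>I. ?C i)"
      using psubset.hyps by (intro compact_UN) auto
    with 2 obtain L U where LU: "(\<Union>i\<in>I. ?C i) = {L..U}"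
      by (meson connected_compact_interval_1)
    have bounds: "L \<le> c i - r i" "c i + r i \<le> U" if "i \<in> I" for i
    proof -
      have "{c i - r i, c i + r i} \<subseteq> (\<Union>i\<in>I. ?C i)"
        using that psubset.prems(1) by force
      then show "L \<le> c i - r i" "c i + r i \<le> U"
        unfolding LU by auto
    qed
    obtain a where a: "a \<in> I" "Min ((\<lambda>i. d i - r i) ` I) = d a - r a"
      using obtains_MIN[OF psubset.hyps 2(1)] .
    obtain b where b: "b \<in> I" "Max ((\<lambda>i. d i + r i) ` I) = d b + r b"
      using obtains_MAX[OF psubset.hyps 2(1)] .
    have ab: "d a - r a \<le> d i - r i" "d i + r i \<le> d b + r b" if "i \<in> I" for i
      using that psubset.hyps unfolding a(2)[symmetric] b(2)[symmetric] by auto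
    have "(\<Union>i\<in>I. ?D i) \<subseteq> {d a - r a .. d b + r b}"
      using ab by force
    then have "emeasure lborel (\<Union>i\<in>I. ?D i) \<le> emeasure lborel {d a - r a .. d b + r b}"
      by (intro emeasure_mono) auto
    also have "\<dots> \<le> emeasure lborel {L..U}"
    proof -
      have "(d b + r b) - (d a - r a) \<le> r a + r b + \<bar>c a - c b\<bar>"
        using psubset.prems(2)[OF a(1) b(1)] by linarith
      also have "\<dots> \<le> U - L"
        using bounds[OF a(1)] bounds[OF b(1)]
          psubset.prems(1)[OF a(1)] psubset.prems(1)[OF b(1)] by linarith
      finally show ?thesis
        by (auto simp: emeasure_lborel_Icc_eq intro!: ennreal_leI)
    qed
    finally show ?thesis
      unfolding LU .
  next
    case 3
    then obtain A B where AB: "closed A" "closed B" "(\<Union>i\<in>I. ?C i) \<subseteq> A \<union> B"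
      "A \<inter> B \<inter> (\<Union>i\<in>I. ?C i) = {}" "A \<inter> (\<Union>i\<in>I. ?C i) \<noteq> {}" "B \<inter> (\<Union>i\<in>I. ?C i) \<noteq> {}"
      unfolding connected_closed by blast
    \<comment> \<open>Each segment, being connected, lies on one side of the separation, so the measure of the
      original union is additive over the two sides, while that of the contracted one is
      subadditive.\<close>
    define IA IB where "IA = {i\<in>I. ?C i \<subseteq> A}" and "IB = {i\<in>I. ?C i \<subseteq> B}"
    have side: "?C i \<subseteq> A \<or> ?C i \<subseteq> B" if "i \<in> I" for i
    proof -
      have "?C i \<subseteq> A \<union> B" "A \<inter> B \<inter> ?C i = {}"
        using AB(3,4) that by blast+
      with connected_closedD[OF connected_Icc _ _ AB(1,2)]
      have "A \<inter> ?C i = {} \<or> B \<inter> ?C i = {}"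
        by blast
      with \<open>?C i \<subseteq> A \<union> B\<close> show ?thesis
        by blast
    qed
    have split: "I = IA \<union> IB"
      using side by (auto simp: IA_def IB_def)
    have disj: "(\<Union>i\<in>IA. ?C i) \<inter> (\<Union>i\<in>IB. ?C i) = {}"
      using AB(4) by (auto simp: IA_def IB_def)
    have "IA \<subset> I"
    proof -
      obtain x i where "i \<in> I" "x \<in> ?C i" "x \<in> B" "x \<notin> A"
        using AB(4,6) by blast
      then have "i \<notin> IA"
        by (auto simp: IA_def)
      with \<open>i \<in> I\<close> show ?thesis
        by (auto simp: IA_def)
    qed
    have "IB \<subset> I"
    proof -
      obtain x i where "i \<in> I" "x \<in> ?C i" "x \<in> A" "x \<notin> B"
        using AB(4,5) by blast
      then have "i \<notin> IB"
        by (auto simp: IB_def)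
      with \<open>i \<in> I\<close> show ?thesis
        by (auto simp: IB_def)
    qed
    have C: "emeasure lborel (\<Union>i\<in>I. ?C i)
        = emeasure lborel (\<Union>i\<in>IA. ?C i) + emeasure lborel (\<Union>i\<in>IB. ?C i)"
      unfolding split UN_Un
      by (rule plus_emeasure[symmetric]; (rule borel disj)?) (auto simp: split)
    have IH: "emeasure lborel (\<Union>i\<in>J. ?D i) \<le> emeasure lborel (\<Union>i\<in>J. ?C i)"
      if "J \<subset> I" for J
      using that psubset.prems by (intro psubset.IH) auto
    have "emeasure lborel (\<Union>i\<in>I. ?D i)
        \<le> emeasure lborel (\<Union>i\<in>IA. ?D i) + emeasure lborel (\<Union>i\<in>IB. ?D i)"
      unfolding split UN_Un
      by (rule emeasure_subadditive; rule borel) (auto simp: split)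
    also have "\<dots> \<le> emeasure lborel (\<Union>i\<in>I. ?C i)"
      unfolding C by (intro add_mono IH \<open>IA \<subset> I\<close> \<open>IB \<subset> I\<close>)
    finally show ?thesis .
  qed
qed

lemma emeasure_UN_intervals_mono:
  fixes c d r :: "'i \<Rightarrow> real"
  assumes "finite I"
    and "\<And>i j. i \<in> I \<Longrightarrow> j \<in> I \<Longrightarrow> \<bar>d i - d j\<bar> \<le> \<bar>c i - c j\<bar>"
  shows "emeasure lborel (\<Union>i\<in>I. {d i - r i .. d i + r i})
       \<le> emeasure lborel (\<Union>i\<in>I. {c i - r i .. c i + r i})"
proof -
  have nonempty: "(\<Union>i\<in>I. {f i - r i .. f i + r i}) = (\<Union>i\<in>{i\<in>I. 0 \<le> r i}. {f i - r i .. f i + r i})"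
    for f :: "'i \<Rightarrow> real"
    by force
  show ?thesis
    by (subst (1 2) nonempty, rule emeasure_UN_nonempty_intervals_mono) (use assms in auto)
qed

section \<open>Comparing volumes along parallel lines\<close>

text \<open>
  Lebesgue measure is the product of its one-dimensional copies along the basis vectors; splitting
  off the factor of \<open>b\<close> writes the measure of a set as the integral of the lengths of its
  sections parallel to \<open>b\<close>.
\<close>

lemma emeasure_lborel_le_if_line_sections_le:
  fixes A B :: "'a::euclidean_space set"
  assumes [measurable]: "A \<in> sets borel" "B \<in> sets borel" and "b \<in> Basis"
    and le: "\<And>x. emeasure lborel {t::real. x + t *\<^sub>R b \<in> A} \<le> emeasure lborel {t. x + t *\<^sub>R b \<in> B}"
  shows "emeasure lborel A \<le> emeasure lborel B"
proof -
  interpret product_sigma_finite "\<lambda>_::'a. lborel :: real measure"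
    by standard
  let ?s = "\<lambda>f. \<Sum>c\<in>Basis. f c *\<^sub>R c :: 'a"
  have Fubini: "emeasure lborel S = (\<integral>\<^sup>+f. emeasure lborel {t. (\<Sum>c\<in>Basis - {b}. f c *\<^sub>R c) + t *\<^sub>R b \<in> S}
      \<partial>Pi\<^sub>M (Basis - {b}) (\<lambda>_. lborel))" if [measurable]: "S \<in> sets borel" for S :: "'a set"
  proof -
    have ins: "insert b (Basis - {b}) = Basis"
      using \<open>b \<in> Basis\<close> by blast
    have upd: "?s (f(b := t)) = (\<Sum>c\<in>Basis - {b}. f c *\<^sub>R c) + t *\<^sub>R b" for f and t :: real
    proof -
      have "(\<Sum>c\<in>Basis - {b}. (f(b := t)) c *\<^sub>R c) = (\<Sum>c\<in>Basis - {b}. f c *\<^sub>R c)"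
        by (intro sum.cong) auto
      then show ?thesis
        using \<open>b \<in> Basis\<close> by (subst sum.remove[of _ b]) auto
    qed
    have "emeasure lborel S = (\<integral>\<^sup>+x. indicator S x \<partial>lborel)"
      by simp
    also have "\<dots> = (\<integral>\<^sup>+f. indicator S (?s f) \<partial>Pi\<^sub>M Basis (\<lambda>_. lborel))"
      by (subst lborel_eq, subst nn_integral_distr) auto
    also have "\<dots> = (\<integral>\<^sup>+f. (\<integral>\<^sup>+t. indicator S (?s (f(b := t))) \<partial>lborel)
        \<partial>Pi\<^sub>M (Basis - {b}) (\<lambda>_. lborel))"
      using product_nn_integral_insert[of "Basis - {b}" b "\<lambda>f. indicator S (?s f)"]
      unfolding ins by simp
    also have "\<dots> = (\<integral>\<^sup>+f. emeasure lborel {t. (\<Sum>c\<in>Basis - {b}. f c *\<^sub>R c) + t *\<^sub>R b \<in> S}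
        \<partial>Pi\<^sub>M (Basis - {b}) (\<lambda>_. lborel))"
    proof (rule nn_integral_cong)
      fix f :: "'a \<Rightarrow> real"
      let ?T = "{t. (\<Sum>c\<in>Basis - {b}. f c *\<^sub>R c) + t *\<^sub>R b \<in> S}"
      have [measurable]: "?T \<in> sets borel"
        by measurable
      have "(\<integral>\<^sup>+t. indicator S (?s (f(b := t))) \<partial>lborel) = (\<integral>\<^sup>+t. indicator ?T t \<partial>lborel)"
        unfolding upd by (intro nn_integral_cong) (auto simp: indicator_def)
      then show "(\<integral>\<^sup>+t. indicator S (?s (f(b := t))) \<partial>lborel) = emeasure lborel ?T"
        by simp
    qed
    finally show ?thesis .
  qed
  show ?thesis
    unfolding Fubini[OF assms(1)] Fubini[OF assms(2)] by (intro nn_integral_mono le)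
qed

section \<open>Moving the points in one coordinate\<close>

text \<open>
  A section of a compact convex set is a segment, and the reflection maps every line parallel to
  the \<open>k\<close>-th axis to itself, so the segment is centred where the \<open>k\<close>-th coordinate
  vanishes. A negative \<open>r\<close> is the case of a line that misses the set.
\<close>

lemma line_section_of_reflection_symmetric:
  fixes K :: "(real ^ 'n) set"
  assumes "compact K" "convex K"
    and reflect: "\<And>x. x \<in> K \<Longrightarrow> x - (2 * x $ k) *\<^sub>R axis k 1 \<in> K"
  obtains r where "\<And>t. u + t *\<^sub>R axis k 1 \<in> K \<longleftrightarrow> \<bar>u $ k + t\<bar> \<le> r"
proof -
  \<comment> \<open>The line is parametrised by its \<open>k\<close>-th coordinate, which makes its section symmetric about 0.\<close>
  define S where "S = {s. u + (s - u $ k) *\<^sub>R axis k 1 \<in> K}"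
  have "closed S"
    using continuous_closed_vimage[OF compact_imp_closed[OF \<open>compact K\<close>],
        of "\<lambda>s. u + (s - u $ k) *\<^sub>R axis k 1"]
    by (simp add: S_def vimage_def continuous_intros)
  moreover have "bounded S"
  proof -
    obtain B where B: "\<And>x. x \<in> K \<Longrightarrow> norm x \<le> B"
      using compact_imp_bounded[OF \<open>compact K\<close>] unfolding bounded_iff by blast
    have "norm s \<le> B" if "s \<in> S" for s
    proof -
      let ?x = "u + (s - u $ k) *\<^sub>R axis k 1"
      have "\<bar>?x $ k\<bar> \<le> B"
        using component_le_norm_cart[of ?x k] B[of ?x] that by (auto simp: S_def)
      then show ?thesis by simp
    qed
    then show ?thesis unfolding bounded_iff by blast
  qed
  moreover have "convex S"
  proof (rule convexI)
    fix s t a b :: real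
    assume *: "s \<in> S" "t \<in> S" "0 \<le> a" "0 \<le> b" "a + b = 1"
    then have "a *\<^sub>R (u + (s - u $ k) *\<^sub>R axis k 1) + b *\<^sub>R (u + (t - u $ k) *\<^sub>R axis k 1) \<in> K"
      using \<open>convex K\<close> by (intro convexD) (auto simp: S_def)
    also have "a *\<^sub>R (u + (s - u $ k) *\<^sub>R axis k 1) + b *\<^sub>R (u + (t - u $ k) *\<^sub>R axis k 1)
        = (a + b) *\<^sub>R u + (a * s + b * t - (a + b) * u $ k) *\<^sub>R axis k 1"
      by (simp add: algebra_simps)
    finally show "a *\<^sub>R s + b *\<^sub>R t \<in> S"
      using *(5) by (simp add: S_def)
  qed
  ultimately obtain l h where S: "S = {l..h}"
    by (metis compact_eq_bounded_closed convex_connected connected_compact_interval_1)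
  have neg: "- s \<in> S" if "s \<in> S" for s
  proof -
    let ?x = "u + (s - u $ k) *\<^sub>R axis k 1"
    have "?x - (2 * ?x $ k) *\<^sub>R axis k 1 = u + (- s - u $ k) *\<^sub>R axis k 1"
      by (simp add: vec_eq_iff axis_def)
    then show ?thesis
      using reflect[of ?x] that unfolding S_def mem_Collect_eq by metis
  qed
  obtain r where r: "S = {- r..r}"
  proof (cases "l \<le> h")
    case True
    then have "l = - h"
      using neg[of l] neg[of h] S by auto
    then show thesis
      using S that by blast
  next
    case False
    then show thesis
      using S that[of "- 1"] by simp
  qed
  show thesis
  proof
    fix t
    have "u + t *\<^sub>R axis k 1 \<in> K \<longleftrightarrow> u $ k + t \<in> S"
      by (simp add: S_def)
    also have "\<dots> \<longleftrightarrow> \<bar>u $ k + t\<bar> \<le> r"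
      unfolding r by (auto simp: abs_le_iff)
    finally show "u + t *\<^sub>R axis k 1 \<in> K \<longleftrightarrow> \<bar>u $ k + t\<bar> \<le> r" .
  qed
qed

text \<open>
  On each line parallel to the \<open>k\<close>-th axis the translates by \<open>p i\<close> and \<open>q i\<close> cut out
  segments of the same radius, because \<open>q i - p i\<close> is parallel to the line: the translate is
  only shifted along it. The centres are \<open>p i $ k\<close> and \<open>q i $ k\<close> up to the common shift
  \<open>x $ k\<close>.
\<close>

lemma emeasure_translates_mono_in_one_coordinate:
  fixes K :: "'i \<Rightarrow> (real ^ 'n) set" and p q :: "'i \<Rightarrow> real ^ 'n"
  assumes "finite I" "I \<noteq> {}"
    and compact: "\<And>i. i \<in> I \<Longrightarrow> compact (K i)"
    and convex: "\<And>i. i \<in> I \<Longrightarrow> convex (K i)"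
    and reflect: "\<And>i x. i \<in> I \<Longrightarrow> x \<in> K i \<Longrightarrow> x - (2 * x $ k) *\<^sub>R axis k 1 \<in> K i"
    and same: "\<And>i l. i \<in> I \<Longrightarrow> l \<noteq> k \<Longrightarrow> q i $ l = p i $ l"
    and contr: "\<And>i j. i \<in> I \<Longrightarrow> j \<in> I \<Longrightarrow> \<bar>q i $ k - q j $ k\<bar> \<le> \<bar>p i $ k - p j $ k\<bar>"
  shows "emeasure lborel (\<Union>i\<in>I. (\<lambda>x. q i + x) ` K i) \<le> emeasure lborel (\<Union>i\<in>I. (\<lambda>x. p i + x) ` K i)"
    and "emeasure lborel (\<Inter>i\<in>I. (\<lambda>x. p i + x) ` K i) \<le> emeasure lborel (\<Inter>i\<in>I. (\<lambda>x. q i + x) ` K i)"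
proof -
  let ?e = "axis k 1 :: real ^ 'n"
  have trans: "y \<in> (\<lambda>x. a + x) ` C \<longleftrightarrow> y - a \<in> C" for y a :: "real ^ 'n" and C
    by (auto simp: image_iff intro: bexI[of _ "y - a"])
  have sections: "\<exists>r. \<forall>f\<in>{p, q}. \<forall>i\<in>I. {t. x + t *\<^sub>R ?e \<in> (\<lambda>x. f i + x) ` K i}
      = {f i $ k - x $ k - r i .. f i $ k - x $ k + r i}" for x
  proof -
    have "\<exists>r. \<forall>t. (x - p i) + t *\<^sub>R ?e \<in> K i \<longleftrightarrow> \<bar>(x - p i) $ k + t\<bar> \<le> r" if "i \<in> I" for i
      using line_section_of_reflection_symmetric[OF compact[OF that] convex[OF that] reflect[OF that]]
      by metis
    then obtain r where r: "\<And>i t. i \<in> I \<Longrightarrow>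
        (x - p i) + t *\<^sub>R ?e \<in> K i \<longleftrightarrow> \<bar>(x - p i) $ k + t\<bar> \<le> r i"
      by metis
    have "x + t *\<^sub>R ?e - f i \<in> K i \<longleftrightarrow> \<bar>x $ k - f i $ k + t\<bar> \<le> r i"
      if "f \<in> {p, q}" "i \<in> I" for f i t
    proof -
      have "x + t *\<^sub>R ?e - f i = (x - p i) + (t - (f i $ k - p i $ k)) *\<^sub>R ?e"
        using that same[OF \<open>i \<in> I\<close>] by (auto simp: vec_eq_iff axis_def)
      also have "\<dots> \<in> K i \<longleftrightarrow> \<bar>(x - p i) $ k + (t - (f i $ k - p i $ k))\<bar> \<le> r i"
        by (rule r[OF \<open>i \<in> I\<close>])
      also have "(x - p i) $ k + (t - (f i $ k - p i $ k)) = x $ k - f i $ k + t"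
        by simp
      finally show ?thesis .
    qed
    then show ?thesis
      unfolding trans by (intro exI[of _ r] ballI set_eqI) (simp add: abs_le_iff, linarith)
  qed
  have borel: "(\<Union>i\<in>I. (\<lambda>x. f i + x) ` K i) \<in> sets borel" "(\<Inter>i\<in>I. (\<lambda>x. f i + x) ` K i) \<in> sets borel"
    for f :: "'i \<Rightarrow> real ^ 'n"
  proof -
    have "(\<lambda>x. f i + x) ` K i \<in> sets borel" if "i \<in> I" for i
      by (rule borel_compact[OF compact_translation[OF compact[OF that]]])
    then show "(\<Union>i\<in>I. (\<lambda>x. f i + x) ` K i) \<in> sets borel" "(\<Inter>i\<in>I. (\<lambda>x. f i + x) ` K i) \<in> sets borel"
      using \<open>finite I\<close> \<open>I \<noteq> {}\<close> by (auto intro: sets.finite_UN sets.finite_INT)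
  qed
  have "?e \<in> Basis"
    by (auto simp: Basis_vec_def)
  have contr': "\<bar>q i $ k - s - (q j $ k - s)\<bar> \<le> \<bar>p i $ k - s - (p j $ k - s)\<bar>"
    if "i \<in> I" "j \<in> I" for i j s
    using contr[OF that] by simp
  have Collect_UN: "{t. x + t *\<^sub>R ?e \<in> (\<Union>i\<in>I. C i)} = (\<Union>i\<in>I. {t. x + t *\<^sub>R ?e \<in> C i})"
    and Collect_INT: "{t. x + t *\<^sub>R ?e \<in> (\<Inter>i\<in>I. C i)} = (\<Inter>i\<in>I. {t. x + t *\<^sub>R ?e \<in> C i})"
    for x :: "real ^ 'n" and C
    by auto
  show "emeasure lborel (\<Union>i\<in>I. (\<lambda>x. q i + x) ` K i) \<le> emeasure lborel (\<Union>i\<in>I. (\<lambda>x. p i + x) ` K i)"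
  proof (rule emeasure_lborel_le_if_line_sections_le[OF borel(1) borel(1) \<open>?e \<in> Basis\<close>])
    fix x
    obtain r where r: "\<forall>f\<in>{p, q}. \<forall>i\<in>I. {t. x + t *\<^sub>R ?e \<in> (\<lambda>x. f i + x) ` K i}
        = {f i $ k - x $ k - r i .. f i $ k - x $ k + r i}"
      using sections ..
    have eq: "{t. x + t *\<^sub>R ?e \<in> (\<Union>i\<in>I. (\<lambda>x. f i + x) ` K i)}
        = (\<Union>i\<in>I. {f i $ k - x $ k - r i .. f i $ k - x $ k + r i})" if "f \<in> {p, q}" for f
      unfolding Collect_UN by (intro SUP_cong refl bspec[OF bspec[OF r that]])
    show "emeasure lborel {t. x + t *\<^sub>R ?e \<in> (\<Union>i\<in>I. (\<lambda>x. q i + x) ` K i)}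
        \<le> emeasure lborel {t. x + t *\<^sub>R ?e \<in> (\<Union>i\<in>I. (\<lambda>x. p i + x) ` K i)}"
      unfolding eq[of p, OF insertI1] eq[of q, OF insertI2[OF singletonI]]
      by (rule emeasure_UN_intervals_mono[OF assms(1)]) (rule contr')
  qed
  show "emeasure lborel (\<Inter>i\<in>I. (\<lambda>x. p i + x) ` K i) \<le> emeasure lborel (\<Inter>i\<in>I. (\<lambda>x. q i + x) ` K i)"
  proof (rule emeasure_lborel_le_if_line_sections_le[OF borel(2) borel(2) \<open>?e \<in> Basis\<close>])
    fix x
    obtain r where r: "\<forall>f\<in>{p, q}. \<forall>i\<in>I. {t. x + t *\<^sub>R ?e \<in> (\<lambda>x. f i + x) ` K i}
        = {f i $ k - x $ k - r i .. f i $ k - x $ k + r i}"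
      using sections ..
    have eq: "{t. x + t *\<^sub>R ?e \<in> (\<Inter>i\<in>I. (\<lambda>x. f i + x) ` K i)}
        = (\<Inter>i\<in>I. {f i $ k - x $ k - r i .. f i $ k - x $ k + r i})" if "f \<in> {p, q}" for f
      unfolding Collect_INT by (intro INF_cong refl bspec[OF bspec[OF r that]])
    show "emeasure lborel {t. x + t *\<^sub>R ?e \<in> (\<Inter>i\<in>I. (\<lambda>x. p i + x) ` K i)}
        \<le> emeasure lborel {t. x + t *\<^sub>R ?e \<in> (\<Inter>i\<in>I. (\<lambda>x. q i + x) ` K i)}"
      unfolding eq[of p, OF insertI1] eq[of q, OF insertI2[OF singletonI]]
      by (rule emeasure_INT_intervals_mono[OF assms(1,2)]) (rule contr')
  qed
qed

section \<open>Moving all coordinates\<close>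

lemma unconditional_reflect:
  assumes "unconditional K" "x \<in> K"
  shows "x - (2 * x $ k) *\<^sub>R axis k 1 \<in> K"
proof -
  let ?s = "\<lambda>l. if l = k then - 1 else 1 :: real"
  have "(\<chi> l. ?s l * x $ l) \<in> K"
    using assms(1)[unfolded unconditional_def, rule_format, OF assms(2), of ?s] by simp
  also have "(\<chi> l. ?s l * x $ l) = x - (2 * x $ k) *\<^sub>R axis k 1"
    by (simp add: vec_eq_iff axis_def)
  finally show ?thesis .
qed

lemma strong_contraction_abs_diff_le:
  assumes "strong_contraction N q p" "i \<in> {1..N}" "j \<in> {1..N}"
  shows "\<bar>q i $ k - q j $ k\<bar> \<le> \<bar>p i $ k - p j $ k\<bar>"
proof -
  consider "i < j" | "i = j" | "j < i" by linarith
  then show ?thesis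
  proof cases
    case 1
    then show ?thesis
      using assms by (simp add: strong_contraction_def)
  next
    case 3
    then have "\<bar>q j $ k - q i $ k\<bar> \<le> \<bar>p j $ k - p i $ k\<bar>"
      using assms by (simp add: strong_contraction_def)
    then show ?thesis
      by (simp add: abs_minus_commute)
  qed simp
qed

theorem theorem1p3:
  fixes N :: nat
    and K :: "nat \<Rightarrow> (real ^ 'n) set"
    and p q :: "nat \<Rightarrow> real ^ 'n"
  assumes "CARD('n) \<ge> 2"
    and "N \<ge> 1"
    and "\<And>i. i \<in> {1..N} \<Longrightarrow> convex_body (K i)"
    and "\<And>i. i \<in> {1..N} \<Longrightarrow> unconditional (K i)"
    and "strong_contraction N q p"
  shows "measure lebesgue (\<Union>i\<in>{1..N}. (\<lambda>x. p i + x) ` K i)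
           \<ge> measure lebesgue (\<Union>i\<in>{1..N}. (\<lambda>x. q i + x) ` K i)
       \<and> measure lebesgue (\<Inter>i\<in>{1..N}. (\<lambda>x. p i + x) ` K i)
           \<le> measure lebesgue (\<Inter>i\<in>{1..N}. (\<lambda>x. q i + x) ` K i)"
proof -
  let ?U = "\<lambda>f. \<Union>i\<in>{1..N}. (\<lambda>x. f i + x) ` K i" and ?J = "\<lambda>f. \<Inter>i\<in>{1..N}. (\<lambda>x. f i + x) ` K i"
  have ne: "{1..N} \<noteq> {}"
    using \<open>N \<ge> 1\<close> by simp
  have compact: "compact (K i)" and convex: "convex (K i)" if "i \<in> {1..N}" for i
    using assms(3)[OF that] by (auto simp: convex_body_def)
  \<comment> \<open>The coordinates in \<open>T\<close> have already been moved.\<close>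
  define mixed where "mixed = (\<lambda>T i. \<chi> k. if k \<in> T then q i $ k else p i $ k)"
  have "emeasure lborel (?U (mixed T)) \<le> emeasure lborel (?U p)
      \<and> emeasure lborel (?J p) \<le> emeasure lborel (?J (mixed T))" for T
  proof (induction T rule: finite_induct[OF finite])
    case 1
    have "mixed {} = p"
      by (simp add: mixed_def)
    then show ?case by simp
  next
    case (2 k T)
    note step = emeasure_translates_mono_in_one_coordinate
      [of "{1..N}" K k "mixed (insert k T)" "mixed T", OF _ ne compact convex unconditional_reflect]
    have "emeasure lborel (?U (mixed (insert k T))) \<le> emeasure lborel (?U (mixed T))"
      "emeasure lborel (?J (mixed T)) \<le> emeasure lborel (?J (mixed (insert k T)))"
      using 2(2) assms(4) strong_contraction_abs_diff_le[OF assms(5)]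
      by (intro step; simp add: mixed_def)+
    with 2(3) show ?case
      by (meson order_trans)
  qed
  from this[of UNIV] have main: "emeasure lborel (?U q) \<le> emeasure lborel (?U p)"
    "emeasure lborel (?J p) \<le> emeasure lborel (?J q)"
    by (simp_all add: mixed_def)
  have compact_U: "compact (?U f)" and compact_J: "compact (?J f)" for f
    using ne by (auto intro!: compact_UN compact_Inter compact_translation compact)
  have measure_mono: "measure lebesgue A \<le> measure lebesgue B"
    if "compact A" "compact B" "emeasure lborel A \<le> emeasure lborel B" for A B :: "(real ^ 'n) set"
    using that emeasure_compact_finite[of B]
    by (simp add: borel_compact measure_def enn2real_mono)
  show ?thesis
    by (intro conjI measure_mono compact_U compact_J main)
qed

end
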